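(* Let $\mathbb{M}$ be a set of stochastic kernels from $\mathbb{X}\times\mathbb{U}$ to $\mathbb{X}$, let $\{\mathcal{T}_n\}_{n\in\mathbb{N}}\subseteq\mathbb{M}$ and $\mathcal{T}\in\mathbb{M}$. (i) Suppose every $M\in\mathbb{M}$ is weak-Feller. If $\mathcal{T}_n\to\mathcal{T}$ weakly uniformly, then $\mathcal{T}_n\to\mathcal{T}$ weakly continuously. (ii) Suppose $\mathbb{X}$ and $\mathbb{U}$ are compact and every $M\in\mathbb{M}$ is weak-Feller. If $\mathcal{T}_n\to\mathcal{T}$ weakly continuously, then $\mathcal{T}_n\to\mathcal{T}$ weakly uniformly. (iii) Suppose the metric space $(\mathbb{M},\rho^{\mathrm{unif}}_{BL})$ is compact and every $M\in\mathbb{M}$ is weak-Feller. If $\mathcal{T}_n\to\mathcal{T}$ pointwise weakly, then $\mathcal{T}_n\to\mathcal{T}$ weakly uniformly.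
   Context: $\mathbb{X}$ and $\mathbb{U}$ are standard Borel spaces (Borel subsets of complete separable metric spaces), with $\mathbb{U}$ compact; $\mathbb{X}\times\mathbb{U}$ carries a product metric $d$. $\mathcal{P}(\mathbb{X})$ is the set of Borel probability measures on $\mathbb{X}$. Bounded Lipschitz metric: for $\mu,\nu\in\mathcal{P}(\mathbb{X})$, $\rho(\mu,\nu)=\sup_{\|f\|_{BL}\le 1}|\int f\,d\mu-\int f\,d\nu|$, where $\|f\|_{BL}=\|f\|_\infty+\sup_{x\ne y}\frac{|f(x)-f(y)|}{d_{\mathbb{X}}(x,y)}$. It metrizes weak convergence on $\mathcal{P}(\mathbb{X})$. A stochastic kernel $M$ is weak-Feller if $M(\cdot|x_n,u_n)\to M(\cdot|x,u)$ weakly whenever $(x_n,u_n)\to(x,u)$. Convergence notions for kernels. Pointwise weakly: $\mathcal{T}_n(\cdot|x,u)\to\mathcal{T}(\cdot|x,u)$ weakly for every $(x,u)\in\mathbb{X}\times\mathbb{U}$. Weakly continuously: $\mathcal{T}_n(\cdot|x_n,u_n)\to\mathcal{T}(\cdot|x,u)$ weakly for every sequence $(x_n,u_n)\to(x,u)$ in $\mathbb{X}\times\mathbb{U}$. Weakly uniformly: $\rho^{\mathrm{unif}}_{BL}(\mathcal{T}_n,\mathcal{T}):=\sup_{(x,u)\in\mathbb{X}\times\mathbb{U}}\rho(\mathcal{T}_n(\cdot|x,u),\mathcal{T}(\cdot|x,u))\to 0$. *)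

theory Defs
  imports "HOL-Probability.Probability"
begin

text \<open>
  A standard Borel space is a Borel subset \<open>X\<close> of a complete separable metric space, the latter
  being a type of class \<open>polish_space\<close>.  Its metric is the restriction of \<open>dist\<close>, its Borel
  sigma-algebra is \<open>restrict_space borel X\<close>, and the product carries \<open>dist\<close> of the product type.
  Only the values of test functions on \<open>X\<close> matter.
\<close>

definition weak_conv_on ::
  "'x::metric_space set \<Rightarrow> (nat \<Rightarrow> 'x measure) \<Rightarrow> 'x measure \<Rightarrow> bool" where
  "weak_conv_on X \<mu> \<nu> \<longleftrightarrow>
     (\<forall>f :: 'x \<Rightarrow> real. continuous_on X f \<and> bounded (f ` X) \<longrightarrow>
        (\<lambda>n. \<integral>x. f x \<partial>\<mu> n) \<longlonglongrightarrow> (\<integral>x. f x \<partial>\<nu>))"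

text \<open>
  Suprema of nonnegative quantities are taken in \<^typ>\<open>ennreal\<close>, so that they are \<open>\<infinity>\<close> for
  unbounded families and \<open>0\<close> for empty ones (e.g. the Lipschitz seminorm when \<open>X\<close> is a singleton).
\<close>

definition BL_norm :: "'x::metric_space set \<Rightarrow> ('x \<Rightarrow> real) \<Rightarrow> ennreal" where
  "BL_norm X f = (SUP x\<in>X. ennreal \<bar>f x\<bar>) +
     (SUP (x, y)\<in>{(x, y). x \<in> X \<and> y \<in> X \<and> x \<noteq> y}. ennreal (\<bar>f x - f y\<bar> / dist x y))"

definition rho_BL :: "'x::metric_space set \<Rightarrow> 'x measure \<Rightarrow> 'x measure \<Rightarrow> ennreal" where
  "rho_BL X \<mu> \<nu> = (SUP f\<in>{f. BL_norm X f \<le> 1}. ennreal \<bar>(\<integral>x. f x \<partial>\<mu>) - (\<integral>x. f x \<partial>\<nu>)\<bar>)"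

text \<open>
  A kernel is identified with its values on \<open>X \<times> U\<close>: it is \<open>undefined\<close> elsewhere, so that kernels
  that agree on \<open>X \<times> U\<close> are equal.
\<close>

definition stochastic_kernels ::
  "'x::polish_space set \<Rightarrow> 'u::polish_space set \<Rightarrow> ('x \<times> 'u \<Rightarrow> 'x measure) set" where
  "stochastic_kernels X U =
     (restrict_space borel (X \<times> U) \<rightarrow>\<^sub>M prob_algebra (restrict_space borel X)) \<inter> extensional (X \<times> U)"

definition weak_Feller ::
  "'x::metric_space set \<Rightarrow> 'u::metric_space set \<Rightarrow> ('x \<times> 'u \<Rightarrow> 'x measure) \<Rightarrow> bool" where
  "weak_Feller X U M \<longleftrightarrow>
     (\<forall>z l. (\<forall>n. z n \<in> X \<times> U) \<and> l \<in> X \<times> U \<and> z \<longlonglongrightarrow> l \<longrightarrow> weak_conv_on X (\<lambda>n. M (z n)) (M l))"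

definition conv_pointwise_weakly ::
  "'x::metric_space set \<Rightarrow> 'u::metric_space set \<Rightarrow>
   (nat \<Rightarrow> 'x \<times> 'u \<Rightarrow> 'x measure) \<Rightarrow> ('x \<times> 'u \<Rightarrow> 'x measure) \<Rightarrow> bool" where
  "conv_pointwise_weakly X U T S \<longleftrightarrow> (\<forall>z\<in>X \<times> U. weak_conv_on X (\<lambda>n. T n z) (S z))"

definition conv_weakly_continuously ::
  "'x::metric_space set \<Rightarrow> 'u::metric_space set \<Rightarrow>
   (nat \<Rightarrow> 'x \<times> 'u \<Rightarrow> 'x measure) \<Rightarrow> ('x \<times> 'u \<Rightarrow> 'x measure) \<Rightarrow> bool" where
  "conv_weakly_continuously X U T S \<longleftrightarrow>
     (\<forall>z l. (\<forall>n. z n \<in> X \<times> U) \<and> l \<in> X \<times> U \<and> z \<longlonglongrightarrow> l \<longrightarrow> weak_conv_on X (\<lambda>n. T n (z n)) (S l))"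

definition rho_unif ::
  "'x::metric_space set \<Rightarrow> 'u::metric_space set \<Rightarrow>
   ('x \<times> 'u \<Rightarrow> 'x measure) \<Rightarrow> ('x \<times> 'u \<Rightarrow> 'x measure) \<Rightarrow> ennreal" where
  "rho_unif X U S T = (SUP z\<in>X \<times> U. rho_BL X (S z) (T z))"

definition conv_weakly_uniformly ::
  "'x::metric_space set \<Rightarrow> 'u::metric_space set \<Rightarrow>
   (nat \<Rightarrow> 'x \<times> 'u \<Rightarrow> 'x measure) \<Rightarrow> ('x \<times> 'u \<Rightarrow> 'x measure) \<Rightarrow> bool" where
  "conv_weakly_uniformly X U T S \<longleftrightarrow> (\<lambda>n. rho_unif X U (T n) S) \<longlonglongrightarrow> 0"

text \<open>
  The library's metric spaces have real distances.  \<open>rho_unif\<close> is at most \<open>2\<close> on stochastic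
  kernels, so \<^const>\<open>enn2real\<close> loses nothing; see \<open>rho_unif_le_2\<close> and \<open>Metric_space_rho_unif\<close>.
\<close>

definition rho_unif_real ::
  "'x::metric_space set \<Rightarrow> 'u::metric_space set \<Rightarrow>
   ('x \<times> 'u \<Rightarrow> 'x measure) \<Rightarrow> ('x \<times> 'u \<Rightarrow> 'x measure) \<Rightarrow> real" where
  "rho_unif_real X U S T = enn2real (rho_unif X U S T)"

lemma BL_norm_le_1_abs:
  assumes "BL_norm X f \<le> 1" "x \<in> X"
  shows "\<bar>f x\<bar> \<le> 1"
proof -
  have "ennreal \<bar>f x\<bar> \<le> (SUP x\<in>X. ennreal \<bar>f x\<bar>)" using assms(2) by (rule SUP_upper)
  also have "\<dots> \<le> BL_norm X f" unfolding BL_norm_def by simp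
  also have "\<dots> \<le> ennreal 1" using assms(1) by simp
  finally show ?thesis by (subst (asm) ennreal_le_iff) auto
qed

lemma abs_integral_le_1:
  fixes f :: "'x::metric_space \<Rightarrow> real"
  assumes "\<mu> \<in> space (prob_algebra (restrict_space borel X))" "BL_norm X f \<le> 1"
  shows "\<bar>\<integral>x. f x \<partial>\<mu>\<bar> \<le> 1"
proof (cases "integrable \<mu> f")
  case True
  interpret prob_space \<mu> using assms(1) by (simp add: space_prob_algebra)
  have sp: "space \<mu> = X"
    using assms(1) by (auto simp: space_prob_algebra space_restrict_space dest: sets_eq_imp_space_eq)
  have ae: "AE x in \<mu>. \<bar>f x\<bar> \<le> 1" using BL_norm_le_1_abs[OF assms(2)] sp by (intro AE_I2) auto
  have "\<bar>\<integral>x. f x \<partial>\<mu>\<bar> \<le> (\<integral>x. \<bar>f x\<bar> \<partial>\<mu>)" by (rule integral_abs_bound)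
  also have "\<dots> \<le> 1" by (rule integral_le_const) (use True ae in auto)
  finally show ?thesis .
qed (simp add: not_integrable_integral_eq)

lemma rho_BL_le_2:
  assumes "\<mu> \<in> space (prob_algebra (restrict_space borel X))"
    and "\<nu> \<in> space (prob_algebra (restrict_space borel X))"
  shows "rho_BL X \<mu> \<nu> \<le> 2"
  unfolding rho_BL_def
proof (rule SUP_least, clarify)
  fix f :: "'a \<Rightarrow> real" assume f: "BL_norm X f \<le> 1"
  have "\<bar>(\<integral>x. f x \<partial>\<mu>) - (\<integral>x. f x \<partial>\<nu>)\<bar> \<le> 2"
    using abs_integral_le_1[OF assms(1) f] abs_integral_le_1[OF assms(2) f] by linarith
  then show "ennreal \<bar>(\<integral>x. f x \<partial>\<mu>) - (\<integral>x. f x \<partial>\<nu>)\<bar> \<le> 2"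
    using ennreal_leI by fastforce
qed

lemma stochastic_kernels_space:
  "T \<in> stochastic_kernels X U \<Longrightarrow> z \<in> X \<times> U \<Longrightarrow>
     T z \<in> space (prob_algebra (restrict_space borel X))"
  unfolding stochastic_kernels_def
  by (auto dest!: measurable_space simp: space_restrict_space)

lemma rho_unif_le_2:
  assumes "S \<in> stochastic_kernels X U" "T \<in> stochastic_kernels X U"
  shows "rho_unif X U S T \<le> 2"
  unfolding rho_unif_def
  by (intro SUP_least rho_BL_le_2 stochastic_kernels_space[OF assms(1)]
        stochastic_kernels_space[OF assms(2)])

lemma rho_BL_commute: "rho_BL X \<mu> \<nu> = rho_BL X \<nu> \<mu>"
  unfolding rho_BL_def by (simp add: abs_minus_commute)

lemma rho_BL_triangle: "rho_BL X \<mu> \<kappa> \<le> rho_BL X \<mu> \<nu> + rho_BL X \<nu> \<kappa>"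
proof (subst rho_BL_def, rule SUP_least)
  fix f :: "'a \<Rightarrow> real" assume f: "f \<in> {f. BL_norm X f \<le> 1}"
  let ?I = "\<lambda>\<mu>. \<integral>x. f x \<partial>\<mu>"
  have "ennreal \<bar>?I \<mu> - ?I \<kappa>\<bar> \<le> ennreal (\<bar>?I \<mu> - ?I \<nu>\<bar> + \<bar>?I \<nu> - ?I \<kappa>\<bar>)"
    by (rule ennreal_leI) linarith
  also have "\<dots> = ennreal \<bar>?I \<mu> - ?I \<nu>\<bar> + ennreal \<bar>?I \<nu> - ?I \<kappa>\<bar>" by (rule ennreal_plus) auto
  also have "\<dots> \<le> rho_BL X \<mu> \<nu> + rho_BL X \<nu> \<kappa>"
    unfolding rho_BL_def by (intro add_mono SUP_upper f)
  finally show "ennreal \<bar>?I \<mu> - ?I \<kappa>\<bar> \<le> rho_BL X \<mu> \<nu> + rho_BL X \<nu> \<kappa>" .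
qed

lemma rho_BL_refl: "rho_BL X \<mu> \<mu> = 0"
  unfolding rho_BL_def by (simp add: SUP_constant bot_ennreal)

lemma rho_BL_zero_integral_eq:
  assumes "rho_BL X \<mu> \<nu> = 0" "BL_norm X f \<le> 1"
  shows "(\<integral>x. f x \<partial>\<mu>) = (\<integral>x. f x \<partial>\<nu>)"
proof -
  have "ennreal \<bar>(\<integral>x. f x \<partial>\<mu>) - (\<integral>x. f x \<partial>\<nu>)\<bar> \<le> rho_BL X \<mu> \<nu>"
    unfolding rho_BL_def by (rule SUP_upper) (use assms(2) in simp)
  then show ?thesis using assms(1) by simp
qed

lemma BL_norm_infdist:
  fixes C :: "'x::metric_space set"
  shows "BL_norm X (\<lambda>x. max 0 (1 - real n * infdist x C) / (1 + real n)) \<le> 1" (is "BL_norm X ?f \<le> 1")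
proof -
  have 1: "(SUP x\<in>X. ennreal \<bar>?f x\<bar>) \<le> ennreal (1 / (1 + real n))"
    by (rule SUP_least, rule ennreal_leI) (auto simp: divide_simps infdist_nonneg)
  have 2: "(SUP (x, y)\<in>{(x, y). x \<in> X \<and> y \<in> X \<and> x \<noteq> y}. ennreal (\<bar>?f x - ?f y\<bar> / dist x y))
      \<le> ennreal (real n / (1 + real n))"
  proof (rule SUP_least, clarify, rule ennreal_leI)
    fix x y :: 'x assume "x \<noteq> y"
    have "\<bar>infdist x C - infdist y C\<bar> \<le> dist x y"
      by (metis abs_le_iff infdist_triangle_abs minus_diff_eq)
    then have "real n * \<bar>infdist x C - infdist y C\<bar> \<le> real n * dist x y"
      by (intro mult_left_mono) auto
    then have "\<bar>real n * infdist x C - real n * infdist y C\<bar> \<le> real n * dist x y"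
      by (simp add: abs_mult flip: right_diff_distrib)
    then have "\<bar>max 0 (1 - real n * infdist x C) - max 0 (1 - real n * infdist y C)\<bar> \<le> real n * dist x y"
      by linarith
    moreover have "\<bar>?f x - ?f y\<bar> =
      \<bar>max 0 (1 - real n * infdist x C) - max 0 (1 - real n * infdist y C)\<bar> / (1 + real n)"
      by (simp flip: diff_divide_distrib)
    ultimately have "\<bar>?f x - ?f y\<bar> \<le> (real n * dist x y) / (1 + real n)"
      by (simp add: divide_right_mono)
    then show "\<bar>?f x - ?f y\<bar> / dist x y \<le> real n / (1 + real n)"
      using \<open>x \<noteq> y\<close> by (simp add: pos_divide_le_eq)
  qed
  have "BL_norm X ?f \<le> ennreal (1 / (1 + real n)) + ennreal (real n / (1 + real n))"
    unfolding BL_norm_def by (rule add_mono[OF 1 2])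
  also have "\<dots> = ennreal 1"
    by (subst ennreal_plus[symmetric]) (auto simp flip: add_divide_distrib)
  finally show ?thesis by simp
qed

lemma rho_BL_zero_imp_eq:
  fixes X :: "'x::metric_space set"
  assumes \<mu>: "\<mu> \<in> space (prob_algebra (restrict_space borel X))"
    and \<nu>: "\<nu> \<in> space (prob_algebra (restrict_space borel X))"
    and 0: "rho_BL X \<mu> \<nu> = 0"
  shows "\<mu> = \<nu>"
proof -
  let ?B = "restrict_space borel X :: 'x measure"
  have lim: "(\<lambda>n. \<integral>x. max 0 (1 - real n * infdist x C) \<partial>\<kappa>) \<longlonglongrightarrow> measure \<kappa> (C \<inter> X)"
    if \<kappa>: "\<kappa> \<in> space (prob_algebra ?B)" and C: "closed C" "C \<noteq> {}" for \<kappa> C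
  proof -
    interpret prob_space \<kappa> using \<kappa> by (simp add: space_prob_algebra)
    have s[measurable_cong]: "sets \<kappa> = sets ?B" using \<kappa> by (simp add: space_prob_algebra)
    have sp: "space \<kappa> = X" using sets_eq_imp_space_eq[OF s] by (simp add: space_restrict_space)
    have m: "(\<lambda>x. g x) \<in> borel_measurable \<kappa>" if "g \<in> borel_measurable borel" for g :: "'x \<Rightarrow> real"
      using measurable_restrict_space1[OF that] measurable_cong_sets[OF s refl] by blast
    have "(\<lambda>n. \<integral>x. max 0 (1 - real n * infdist x C) \<partial>\<kappa>) \<longlonglongrightarrow> (\<integral>x. indicator C x \<partial>\<kappa>)"
    proof (rule integral_dominated_convergence[where w = "\<lambda>_. 1"])
      show "(indicator C :: 'x \<Rightarrow> real) \<in> borel_measurable \<kappa>" using m[OF borel_measurable_indicator[OF borel_closed[OF C(1)]]] .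
      show "(\<lambda>x. max 0 (1 - real n * infdist x C)) \<in> borel_measurable \<kappa>" for n
        by (rule m, rule borel_measurable_continuous_onI) (intro continuous_intros)
      show "AE x in \<kappa>. norm (max 0 (1 - real n * infdist x C)) \<le> 1" for n
        by (rule AE_I2) (auto simp: infdist_nonneg)
      show "AE x in \<kappa>. (\<lambda>n. max 0 (1 - real n * infdist x C)) \<longlonglongrightarrow> indicator C x"
      proof (rule AE_I2)
        fix x
        show "(\<lambda>n. max 0 (1 - real n * infdist x C)) \<longlonglongrightarrow> indicator C x"
        proof (cases "x \<in> C")
          case True then show ?thesis by simp
        next
          case False
          then have d: "infdist x C > 0"
            using C in_closed_iff_infdist_zero[of C x] infdist_nonneg[of x C] by auto
          obtain N where N: "1 < real N * infdist x C" using reals_Archimedean3[OF d] by blast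
          have "max 0 (1 - real n * infdist x C) = indicator C x" if "n \<ge> N" for n
          proof -
            have "real N * infdist x C \<le> real n * infdist x C"
              using that d by (intro mult_right_mono) auto
            then show ?thesis using N False by simp
          qed
          then show ?thesis
            by (intro tendsto_eventually eventually_sequentiallyI[of N])
        qed
      qed
    qed simp
    then show ?thesis by (simp add: sp)
  qed
  have eq: "measure \<mu> (C \<inter> X) = measure \<nu> (C \<inter> X)" if C: "closed C" for C
  proof (cases "C = {}")
    case False
    have "(\<integral>x. max 0 (1 - real n * infdist x C) \<partial>\<mu>) = (\<integral>x. max 0 (1 - real n * infdist x C) \<partial>\<nu>)" for n
      using rho_BL_zero_integral_eq[OF 0 BL_norm_infdist[of X n C]] by simp
    then show ?thesis using lim[OF \<mu> C False] lim[OF \<nu> C False] LIMSEQ_unique by simp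
  qed simp
  have sm: "sets \<mu> = sets ?B" and sn: "sets \<nu> = sets ?B"
    using \<mu> \<nu> by (simp_all add: space_prob_algebra)
  have spm: "space \<mu> = X" and spn: "space \<nu> = X"
    using sets_eq_imp_space_eq[OF sm] sets_eq_imp_space_eq[OF sn] by (simp_all add: space_restrict_space)
  interpret m: prob_space \<mu> using \<mu> by (simp add: space_prob_algebra)
  interpret n: prob_space \<nu> using \<nu> by (simp add: space_prob_algebra)
  have im: "(\<lambda>x. x) \<in> \<mu> \<rightarrow>\<^sub>M borel" "(\<lambda>x. x) \<in> \<nu> \<rightarrow>\<^sub>M borel"
    using measurable_restrict_space1[of "\<lambda>x. x" borel borel X]
      measurable_cong_sets[OF sm refl] measurable_cong_sets[OF sn refl] by auto
  have D: "distr \<mu> borel (\<lambda>x. x) = distr \<nu> borel (\<lambda>x. x)"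
  proof (rule measure_eqI_generator_eq[where E = "Collect closed" and \<Omega> = UNIV and A = "\<lambda>_. UNIV"])
    show "Int_stable (Collect closed :: 'x set set)" by (auto simp: Int_stable_def)
    show "sets (distr \<mu> borel (\<lambda>x. x)) = sigma_sets UNIV (Collect closed)"
      "sets (distr \<nu> borel (\<lambda>x. x)) = sigma_sets UNIV (Collect closed)"
      by (simp_all add: borel_eq_closed)
    show "emeasure (distr \<mu> borel (\<lambda>x. x)) C = emeasure (distr \<nu> borel (\<lambda>x. x)) C"
      if "C \<in> Collect closed" for C
      using that eq[of C]
      by (simp add: emeasure_distr im spm spn m.emeasure_eq_measure n.emeasure_eq_measure)
  qed (auto simp: emeasure_distr im m.emeasure_eq_measure)
  show ?thesis
  proof (rule measure_eqI)
    fix A assume "A \<in> sets \<mu>"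
    then obtain B where B: "B \<in> sets borel" "A = B \<inter> X"
      unfolding sm sets_restrict_space by auto
    have "emeasure (distr \<mu> borel (\<lambda>x. x)) B = emeasure (distr \<nu> borel (\<lambda>x. x)) B" by (simp add: D)
    then show "emeasure \<mu> A = emeasure \<nu> A"
      using B by (simp add: emeasure_distr im spm spn)
  qed (simp add: sm sn)
qed

lemma Metric_space_rho_unif:
  assumes "\<MM> \<subseteq> stochastic_kernels X U"
  shows "Metric_space \<MM> (rho_unif_real X U)"
proof
  have fin: "rho_unif X U S T < \<top>" if "S \<in> \<MM>" "T \<in> \<MM>" for S T
  proof -
    have "rho_unif X U S T \<le> 2" using that assms by (intro rho_unif_le_2) auto
    also have "(2::ennreal) < \<top>" by simp
    finally show ?thesis .
  qed
  show "0 \<le> rho_unif_real X U S T" for S T by (simp add: rho_unif_real_def)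
  show "rho_unif_real X U S T = rho_unif_real X U T S" for S T
    unfolding rho_unif_real_def rho_unif_def by (subst rho_BL_commute) (rule refl)
  show "(rho_unif_real X U S T = 0) = (S = T)" if S: "S \<in> \<MM>" and T: "T \<in> \<MM>" for S T
  proof
    assume "S = T" then show "rho_unif_real X U S T = 0"
      by (simp add: rho_unif_real_def rho_unif_def rho_BL_refl SUP_constant bot_ennreal)
  next
    assume "rho_unif_real X U S T = 0"
    then have 0: "rho_unif X U S T = 0"
      using fin[OF S T] by (auto simp: rho_unif_real_def enn2real_eq_0_iff)
    have ST: "S \<in> stochastic_kernels X U" "T \<in> stochastic_kernels X U" using S T assms by auto
    show "S = T"
    proof (rule extensionalityI)
      show "S \<in> extensional (X \<times> U)" "T \<in> extensional (X \<times> U)"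
        using ST by (auto simp: stochastic_kernels_def)
      fix z assume z: "z \<in> X \<times> U"
      have "rho_BL X (S z) (T z) \<le> rho_unif X U S T"
        unfolding rho_unif_def by (rule SUP_upper[OF z])
      then have "rho_BL X (S z) (T z) = 0" using 0 by simp
      then show "S z = T z"
        using rho_BL_zero_imp_eq stochastic_kernels_space[OF ST(1) z] stochastic_kernels_space[OF ST(2) z]
        by blast
    qed
  qed
  show "rho_unif_real X U R T \<le> rho_unif_real X U R S + rho_unif_real X U S T"
    if "R \<in> \<MM>" "S \<in> \<MM>" "T \<in> \<MM>" for R S T
  proof -
    have "rho_unif X U R T \<le> rho_unif X U R S + rho_unif X U S T"
      unfolding rho_unif_def
    proof (rule SUP_least)
      fix z assume z: "z \<in> X \<times> U"
      have "rho_BL X (R z) (T z) \<le> rho_BL X (R z) (S z) + rho_BL X (S z) (T z)"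
        by (rule rho_BL_triangle)
      also have "\<dots> \<le> (SUP z\<in>X \<times> U. rho_BL X (R z) (S z)) + (SUP z\<in>X \<times> U. rho_BL X (S z) (T z))"
        by (intro add_mono SUP_upper z)
      finally show "rho_BL X (R z) (T z) \<le>
        (SUP z\<in>X \<times> U. rho_BL X (R z) (S z)) + (SUP z\<in>X \<times> U. rho_BL X (S z) (T z))" .
    qed
    then have "enn2real (rho_unif X U R T) \<le> enn2real (rho_unif X U R S + rho_unif X U S T)"
      using fin[OF that(1,2)] fin[OF that(2,3)] by (intro enn2real_mono) simp_all
    also have "\<dots> = rho_unif_real X U R S + rho_unif_real X U S T"
      using fin[OF that(1,2)] fin[OF that(2,3)] by (simp add: enn2real_plus rho_unif_real_def)
    finally show ?thesis by (simp add: rho_unif_real_def)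
  qed
qed

end

theory Submission
  imports Defs
begin

text \<open>
  By inf-convolution with multiples of the distance, convergence of integrals of bounded Lipschitz
  functions already gives weak convergence.  Hence (i) only needs, for each single test function,
  the triangle inequality through the integral against \<open>S (z n)\<close>.  On a compact space a partition
  of unity subordinate to a finite \<open>\<delta>\<close>-net reduces \<^const>\<open>rho_BL\<close>, up to \<open>2\<delta>\<close>, to finitely many
  test functions, so weak convergence implies \<^const>\<open>rho_BL\<close>-convergence; (ii) follows by extracting
  convergent subsequences of almost maximising points.  In (iii) a uniform subsequential limit
  is also a pointwise weak limit, hence equals \<open>S\<close>.
\<close>

section \<open>Integrability and the bounded Lipschitz unit ball\<close>

lemma space_prob_algebra_restrict_borel:
  assumes "\<mu> \<in> space (prob_algebra (restrict_space borel X))"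
  shows "space \<mu> = X"
  using assms by (auto simp: space_prob_algebra space_restrict_space dest: sets_eq_imp_space_eq)

lemma integrable_prob_algebra_bounded_continuous:
  fixes f :: "'x::metric_space \<Rightarrow> real"
  assumes \<mu>: "\<mu> \<in> space (prob_algebra (restrict_space borel X))"
    and "continuous_on X f" "bounded (f ` X)"
  shows "integrable \<mu> f"
proof -
  interpret prob_space \<mu> using \<mu> by (simp add: space_prob_algebra)
  have s: "sets \<mu> = sets (restrict_space borel X)" using \<mu> by (simp add: space_prob_algebra)
  have m: "f \<in> borel_measurable \<mu>"
    using borel_measurable_continuous_on_restrict[OF assms(2)] measurable_cong_sets[OF s refl] by blast
  obtain B where "\<And>x. x \<in> X \<Longrightarrow> norm (f x) \<le> B"
    using assms(3) by (auto simp: bounded_iff)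
  then show ?thesis
    using m space_prob_algebra_restrict_borel[OF \<mu>] by (intro integrable_const_bound[where B=B] AE_I2) auto
qed

lemma BL_norm_le_1_dist:
  assumes "BL_norm X f \<le> 1" "x \<in> X" "y \<in> X"
  shows "\<bar>f x - f y\<bar> \<le> dist x y"
proof (cases "x = y")
  case False
  let ?A = "{(x, y). x \<in> X \<and> y \<in> X \<and> x \<noteq> y}"
  have "ennreal (\<bar>f x - f y\<bar> / dist x y) \<le> (SUP (x, y)\<in>?A. ennreal (\<bar>f x - f y\<bar> / dist x y))"
    by (rule SUP_upper2[of "(x, y)"]) (use assms False in auto)
  also have "\<dots> \<le> BL_norm X f" unfolding BL_norm_def by simp
  also have "\<dots> \<le> ennreal 1" using assms(1) by simp
  finally have "\<bar>f x - f y\<bar> / dist x y \<le> 1" by (subst (asm) ennreal_le_iff) auto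
  then show ?thesis using False by (simp add: pos_divide_le_eq)
qed simp

text \<open>The unit budget is split between a sup bound \<open>a\<close> and a Lipschitz constant
  \<open>b\<close>. In this form, a bounded Lipschitz function enters the unit ball after division
  by a large enough constant.\<close>

lemma BL_norm_le_1I:
  assumes "\<And>x. x \<in> X \<Longrightarrow> \<bar>f x\<bar> \<le> a"
    and "\<And>x y. x \<in> X \<Longrightarrow> y \<in> X \<Longrightarrow> \<bar>f x - f y\<bar> \<le> b * dist x y"
    and "0 \<le> a" "0 \<le> b" "a + b \<le> 1"
  shows "BL_norm X f \<le> 1"
proof -
  have "(SUP x\<in>X. ennreal \<bar>f x\<bar>) \<le> ennreal a"
    by (intro SUP_least ennreal_leI assms)
  moreover have "(SUP (x, y)\<in>{(x, y). x \<in> X \<and> y \<in> X \<and> x \<noteq> y}.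
      ennreal (\<bar>f x - f y\<bar> / dist x y)) \<le> ennreal b"
    by (rule SUP_least, clarify, rule ennreal_leI) (simp add: pos_divide_le_eq assms)
  ultimately have "BL_norm X f \<le> ennreal a + ennreal b"
    unfolding BL_norm_def by (rule add_mono)
  also have "\<dots> = ennreal (a + b)" using assms by simp
  also have "\<dots> \<le> 1" using assms ennreal_leI[of "a + b" 1] by simp
  finally show ?thesis .
qed

lemma BL_norm_le_1_continuous_on:
  fixes f :: "'x::metric_space \<Rightarrow> real"
  assumes "BL_norm X f \<le> 1"
  shows "continuous_on X f"
  unfolding continuous_on_iff
  using BL_norm_le_1_dist[OF assms] by (metis dist_real_def order_le_less_trans)

lemma BL_norm_le_1_bounded:
  assumes "BL_norm X f \<le> 1"
  shows "bounded (f ` X)"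
  using BL_norm_le_1_abs[OF assms] by (auto simp: bounded_iff)

section \<open>From bounded Lipschitz test functions to weak convergence\<close>

lemma abs_integral_diff_le_rho_BL:
  assumes "BL_norm X f \<le> 1"
  shows "ennreal \<bar>(\<integral>x. f x \<partial>\<mu>) - (\<integral>x. f x \<partial>\<nu>)\<bar> \<le> rho_BL X \<mu> \<nu>"
  unfolding rho_BL_def by (rule SUP_upper) (use assms in simp)

text \<open>Both measures vary with \<open>n\<close>, because under uniform convergence of kernels
  \<open>T n (z n)\<close> is close to \<open>S (z n)\<close>, which itself moves.\<close>

lemma integral_diff_tendsto_0_if_rho_BL:
  assumes "(\<lambda>n. rho_BL X (\<mu> n) (\<nu> n)) \<longlonglongrightarrow> 0" "BL_norm X f \<le> 1"
  shows "(\<lambda>n. (\<integral>x. f x \<partial>\<mu> n) - (\<integral>x. f x \<partial>\<nu> n)) \<longlonglongrightarrow> 0"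
proof -
  have "(\<lambda>n. ennreal \<bar>(\<integral>x. f x \<partial>\<mu> n) - (\<integral>x. f x \<partial>\<nu> n)\<bar>) \<longlonglongrightarrow> 0"
    by (rule tendsto_sandwich[OF _ _ tendsto_const assms(1)])
      (auto intro!: always_eventually abs_integral_diff_le_rho_BL assms(2))
  then have "(\<lambda>n. \<bar>(\<integral>x. f x \<partial>\<mu> n) - (\<integral>x. f x \<partial>\<nu> n)\<bar>) \<longlonglongrightarrow> 0"
    by (simp add: ennreal_tendsto_0_iff)
  then show ?thesis by (simp add: tendsto_rabs_zero_iff)
qed

text \<open>This is the lower half of weak convergence. Lipschitz minorants \<open>g k\<close> of
  \<open>f\<close> converge to \<open>f\<close> pointwise on \<open>X\<close>, so by dominated
  convergence some \<open>g k\<close> already has \<open>\<nu>\<close>-integral above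
  \<open>a\<close>. The hypothesis on test functions applies to this \<open>g k\<close>, and
  \<open>g k \<le> f\<close> on \<open>X\<close> carries the strict bound over to
  \<open>f\<close>.\<close>

lemma eventually_integral_greater_if_BL:
  fixes f :: "'x::metric_space \<Rightarrow> real"
  assumes \<mu>: "\<And>n. \<mu> n \<in> space (prob_algebra (restrict_space borel X))"
    and \<nu>: "\<nu> \<in> space (prob_algebra (restrict_space borel X))"
    and conv: "\<And>h. BL_norm X h \<le> 1 \<Longrightarrow> (\<lambda>n. \<integral>x. h x \<partial>\<mu> n) \<longlonglongrightarrow> (\<integral>x. h x \<partial>\<nu>)"
    and f: "continuous_on X f" "bounded (f ` X)" and a: "a < (\<integral>x. f x \<partial>\<nu>)"
  shows "\<forall>\<^sub>F n in sequentially. a < (\<integral>x. f x \<partial>\<mu> n)"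
proof -
  interpret prob_space \<nu> using \<nu> by (simp add: space_prob_algebra)
  have sp: "space \<nu> = X" "space (\<mu> n) = X" for n
    using \<nu> \<mu> space_prob_algebra_restrict_borel by auto
  have ne: "X \<noteq> {}" using not_empty sp by simp
  obtain B where B: "\<And>x. x \<in> X \<Longrightarrow> \<bar>f x\<bar> \<le> B"
    using f(2) by (auto simp: bounded_iff)
  have B0: "0 \<le> B" using B ne by fastforce
  \<comment> \<open>The Pasch-Hausdorff envelope: \<open>g k\<close> is \<open>k\<close>-Lipschitz,
    and choosing \<open>y = x\<close> shows that it lies below \<open>f\<close> on
    \<open>X\<close>.\<close>
  define g where "g k x = (INF y\<in>X. f y + real k * dist x y)" for k x
  have ge: "- B \<le> f y + real k * dist x y" if "y \<in> X" for x y k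
    using B[OF that] mult_nonneg_nonneg[OF of_nat_0_le_iff zero_le_dist, of k x y] by linarith
  have bdd: "bdd_below ((\<lambda>y. f y + real k * dist x y) ` X)" for k x
    using ge by (intro bdd_belowI2[where m = "- B"])
  have g_le: "g k x \<le> f x" if "x \<in> X" for k x
    unfolding g_def using cINF_lower[OF bdd that, of k x] by simp
  have g_ge: "- B \<le> g k x" for k x
    unfolding g_def by (intro cINF_greatest ne ge)
  have g_abs: "\<bar>g k x\<bar> \<le> B" if "x \<in> X" for k x
    using g_le[OF that, of k] g_ge[of k x] B[OF that] by linarith
  have g_lip: "g k x \<le> g k y + real k * dist x y" for k x y
  proof -
    have "g k x - real k * dist x y \<le> g k y"
      unfolding g_def[of k y]
    proof (rule cINF_greatest[OF ne])
      fix w assume "w \<in> X"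
      then have "g k x \<le> f w + real k * dist x w" unfolding g_def by (rule cINF_lower[OF bdd])
      also have "\<dots> \<le> f w + real k * (dist x y + dist y w)"
        by (intro add_left_mono mult_left_mono dist_triangle) auto
      finally show "g k x - real k * dist x y \<le> f w + real k * dist y w"
        by (simp add: algebra_simps)
    qed
    then show ?thesis by simp
  qed
  have g_lip_abs: "\<bar>g k x - g k y\<bar> \<le> real k * dist x y" for k x y
    using g_lip[of k x y] g_lip[of k y x] by (simp add: dist_commute abs_le_iff)
  \<comment> \<open>The sup bound \<open>B\<close> and the Lipschitz constant \<open>k\<close> add
    up to less than the divisor; the extra \<open>1\<close> keeps the divisor positive even when
    both vanish.\<close>
  have BL: "BL_norm X (\<lambda>x. g k x / (1 + B + real k)) \<le> 1" for k
  proof (rule BL_norm_le_1I[where a = "B / (1 + B + real k)" and b = "real k / (1 + B + real k)"])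
    show "\<bar>g k x / (1 + B + real k) - g k y / (1 + B + real k)\<bar> \<le> real k / (1 + B + real k) * dist x y" for x y
      using g_lip_abs[of k x y] B0
      by (simp add: divide_right_mono flip: diff_divide_distrib)
  qed (use g_abs B0 in \<open>auto simp: divide_right_mono simp flip: add_divide_distrib\<close>)
  have g_cont: "continuous_on X (g k)" for k
    using continuous_on_mult_right[OF BL_norm_le_1_continuous_on[OF BL[of k]], of "1 + B + real k"] B0
    by (simp add: add_nonneg_eq_0_iff)
  have g_bdd: "bounded (g k ` X)" for k using g_abs by (auto simp: bounded_iff)
  have g_conv: "(\<lambda>n. \<integral>x. g k x \<partial>\<mu> n) \<longlonglongrightarrow> (\<integral>x. g k x \<partial>\<nu>)" for k
    using tendsto_mult_left[OF conv[OF BL[of k]], of "1 + B + real k"] B0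
    by (simp add: add_nonneg_eq_0_iff)
  have g_lim: "(\<lambda>k. g k x) \<longlonglongrightarrow> f x" if x: "x \<in> X" for x
  proof (rule LIMSEQ_I)
    fix e :: real assume "0 < e"
    then obtain d where d: "d > 0" "\<And>y. y \<in> X \<Longrightarrow> dist y x < d \<Longrightarrow> dist (f y) (f x) < e / 2"
      using f(1) x unfolding continuous_on_iff by (meson half_gt_zero)
    \<comment> \<open>With slope at least \<open>N\<close>, the penalty at distance \<open>d\<close>
      or more exceeds \<open>2 * B\<close>, the largest possible drop of \<open>f\<close>. Only
      points closer than \<open>d\<close> could then bring the infimum below \<open>f x\<close>, and
      there continuity costs at most \<open>e / 2\<close>.\<close>
    obtain N where N: "2 * B < real N * d" using reals_Archimedean3[OF d(1)] by blast
    have "norm (g k x - f x) < e" if "k \<ge> N" for k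
    proof -
      have "f x - e / 2 \<le> g k x"
        unfolding g_def
      proof (rule cINF_greatest[OF ne])
        fix y assume y: "y \<in> X"
        show "f x - e / 2 \<le> f y + real k * dist x y"
        proof (cases "dist y x < d")
          case True
          then have "f x - e / 2 \<le> f y" using d(2)[OF y True] \<open>0 < e\<close> unfolding dist_real_def by linarith
          then show ?thesis using mult_nonneg_nonneg[OF of_nat_0_le_iff zero_le_dist, of k x y] by linarith
        next
          case False
          have "real N * d \<le> real k * dist x y"
            using False d(1) that by (intro mult_mono) (auto simp: dist_commute)
          then show ?thesis using N B[OF x] B[OF y] \<open>0 < e\<close> by linarith
        qed
      qed
      then show ?thesis using g_le[OF x, of k] \<open>0 < e\<close> by simp
    qed
    then show "\<exists>N. \<forall>k\<ge>N. norm (g k x - f x) < e" by blast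
  qed
  have "(\<lambda>k. \<integral>x. g k x \<partial>\<nu>) \<longlonglongrightarrow> (\<integral>x. f x \<partial>\<nu>)"
    by (rule integral_dominated_convergence[where w = "\<lambda>_. B"])
      (use integrable_prob_algebra_bounded_continuous[OF \<nu>] f g_cont g_bdd g_lim g_abs sp
        in \<open>auto intro!: AE_I2\<close>)
  then obtain k where "a < (\<integral>x. g k x \<partial>\<nu>)"
    using order_tendstoD(1)[OF _ a] eventually_happens' sequentially_bot by blast
  then have "\<forall>\<^sub>F n in sequentially. a < (\<integral>x. g k x \<partial>\<mu> n)"
    by (rule order_tendstoD(1)[OF g_conv])
  then show ?thesis
  proof eventually_elim
    case (elim n)
    have "(\<integral>x. g k x \<partial>\<mu> n) \<le> (\<integral>x. f x \<partial>\<mu> n)"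
      using integrable_prob_algebra_bounded_continuous[OF \<mu>] f g_cont g_bdd g_le sp
      by (intro integral_mono) auto
    then show ?case using elim by simp
  qed
qed

text \<open>The lower bound applied to \<open>f\<close> gives one half of the limit; applied to
  \<open>- f\<close> it gives the upper half.\<close>

lemma weak_conv_on_if_BL:
  fixes \<mu> :: "nat \<Rightarrow> 'x::metric_space measure"
  assumes "\<And>n. \<mu> n \<in> space (prob_algebra (restrict_space borel X))"
    and "\<nu> \<in> space (prob_algebra (restrict_space borel X))"
    and "\<And>h. BL_norm X h \<le> 1 \<Longrightarrow> (\<lambda>n. \<integral>x. h x \<partial>\<mu> n) \<longlonglongrightarrow> (\<integral>x. h x \<partial>\<nu>)"
  shows "weak_conv_on X \<mu> \<nu>"
  unfolding weak_conv_on_def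
proof (intro allI impI, elim conjE)
  fix f :: "'x \<Rightarrow> real" assume f: "continuous_on X f" "bounded (f ` X)"
  have f': "continuous_on X (\<lambda>x. - f x)" "bounded ((\<lambda>x. - f x) ` X)"
    using f by (auto simp: bounded_iff intro: continuous_intros)
  show "(\<lambda>n. \<integral>x. f x \<partial>\<mu> n) \<longlonglongrightarrow> (\<integral>x. f x \<partial>\<nu>)"
  proof (rule order_tendstoI)
    fix a assume a: "a < (\<integral>x. f x \<partial>\<nu>)"
    show "\<forall>\<^sub>F n in sequentially. a < (\<integral>x. f x \<partial>\<mu> n)"
      by (rule eventually_integral_greater_if_BL[where X = X and \<nu> = \<nu>]) (fact assms f a)+
  next
    fix a assume "(\<integral>x. f x \<partial>\<nu>) < a"
    then have a: "- a < (\<integral>x. - f x \<partial>\<nu>)" by simp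
    have "\<forall>\<^sub>F n in sequentially. - a < (\<integral>x. - f x \<partial>\<mu> n)"
      by (rule eventually_integral_greater_if_BL[where X = X and \<nu> = \<nu>]) (fact assms f' a)+
    then show "\<forall>\<^sub>F n in sequentially. (\<integral>x. f x \<partial>\<mu> n) < a" by simp
  qed
qed

section \<open>From weak convergence to \<open>rho_BL\<close> on a compact space\<close>

lemma weak_conv_on_BL:
  assumes "weak_conv_on X \<mu> \<nu>" "BL_norm X f \<le> 1"
  shows "(\<lambda>n. \<integral>x. f x \<partial>\<mu> n) \<longlonglongrightarrow> (\<integral>x. f x \<partial>\<nu>)"
  using assms BL_norm_le_1_continuous_on BL_norm_le_1_bounded unfolding weak_conv_on_def by blast

text \<open>The difficulty is uniformity over the unit ball. A partition of unity
  \<open>\<phi> c\<close> indexed by a finite net \<open>C\<close> replaces every \<open>f\<close>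
  in the ball by the combination of the \<open>\<phi> c\<close> with coefficients
  \<open>f c\<close>, at cost \<open>d\<close>. The functions \<open>\<phi> c\<close> are the same
  for all \<open>f\<close>, so weak convergence is invoked only finitely often.\<close>

lemma compact_rho_BL_tendsto_0_if_weak_conv_on:
  fixes \<mu> :: "nat \<Rightarrow> 'x::metric_space measure"
  assumes X: "compact X"
    and \<mu>: "\<And>n. \<mu> n \<in> space (prob_algebra (restrict_space borel X))"
    and \<nu>: "\<nu> \<in> space (prob_algebra (restrict_space borel X))"
    and conv: "weak_conv_on X \<mu> \<nu>"
  shows "(\<lambda>n. rho_BL X (\<mu> n) \<nu>) \<longlonglongrightarrow> 0"
proof -
  have bound: "\<forall>\<^sub>F n in sequentially. rho_BL X (\<mu> n) \<nu> \<le> ennreal (3 * d)" if d: "0 < d" for d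
  proof -
    obtain C where C: "finite C" "C \<subseteq> X" "X \<subseteq> (\<Union>c\<in>C. ball c d)"
      using compactE_image[OF X, of X "\<lambda>c. ball c d"] d by (metis UN_I centre_in_ball open_ball subsetI)
    \<comment> \<open>The tents \<open>max 0 (d - dist x c)\<close> vanish outside the balls. Since
      the balls cover \<open>X\<close>, their sum \<open>s\<close> is positive there and can serve
      as the normalising denominator.\<close>
    define s where "s x = (\<Sum>c\<in>C. max 0 (d - dist x c))" for x
    define \<phi> where "\<phi> c x = max 0 (d - dist x c) / s x" for c x
    have s_pos: "0 < s x" if x: "x \<in> X" for x
    proof -
      obtain c where "c \<in> C" "dist x c < d" using C(3) x by (auto simp: dist_commute)
      then show ?thesis unfolding s_def by (intro sum_pos2[OF C(1)]) auto
    qed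
    have \<phi>_nonneg: "0 \<le> \<phi> c x" if "x \<in> X" for c x
      using s_pos[OF that] by (simp add: \<phi>_def)
    have \<phi>_sum: "(\<Sum>c\<in>C. \<phi> c x) = 1" if "x \<in> X" for x
      using s_pos[OF that] by (simp add: \<phi>_def s_def flip: sum_divide_distrib)
    have \<phi>_cont: "continuous_on X (\<phi> c)" for c
      unfolding \<phi>_def s_def
      by (intro continuous_intros) (use s_pos in \<open>force simp: s_def\<close>)
    have \<phi>_bdd: "bounded (\<phi> c ` X)" for c
      using compact_continuous_image[OF \<phi>_cont X] by (rule compact_imp_bounded)
    have approx: "\<bar>(\<integral>x. f x \<partial>\<kappa>) - (\<Sum>c\<in>C. f c * (\<integral>x. \<phi> c x \<partial>\<kappa>))\<bar> \<le> d"
      if \<kappa>: "\<kappa> \<in> space (prob_algebra (restrict_space borel X))" and f: "BL_norm X f \<le> 1" for \<kappa> f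
    proof -
      interpret prob_space \<kappa> using \<kappa> by (simp add: space_prob_algebra)
      note int = integrable_prob_algebra_bounded_continuous[OF \<kappa>]
      have int_f[simp]: "integrable \<kappa> f" 
        by (intro int BL_norm_le_1_continuous_on BL_norm_le_1_bounded f)
      have int_\<phi>[simp]: "integrable \<kappa> (\<phi> c)" for c by (intro int \<phi>_cont \<phi>_bdd)
      have pt: "\<bar>f x - (\<Sum>c\<in>C. f c * \<phi> c x)\<bar> \<le> d" if x: "x \<in> X" for x
      proof -
        \<comment> \<open>Because the weights sum to 1, \<open>f x\<close> can be moved inside the
          sum. A term survives only where \<open>dist x c < d\<close>, and there the Lipschitz bound
          controls \<open>f x - f c\<close>.\<close>
        have "f x - (\<Sum>c\<in>C. f c * \<phi> c x) = (\<Sum>c\<in>C. (f x - f c) * \<phi> c x)"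
          using \<phi>_sum[OF x] by (simp add: left_diff_distrib sum_subtractf flip: sum_distrib_left)
        also have "\<bar>\<dots>\<bar> \<le> (\<Sum>c\<in>C. d * \<phi> c x)"
        proof (rule order_trans[OF sum_abs sum_mono])
          fix c assume c: "c \<in> C"
          show "\<bar>(f x - f c) * \<phi> c x\<bar> \<le> d * \<phi> c x"
          proof (cases "dist x c < d")
            case True
            then have "\<bar>f x - f c\<bar> \<le> d" using BL_norm_le_1_dist[OF f x, of c] c C(2) by auto
            then show ?thesis using \<phi>_nonneg[OF x, of c] by (simp add: abs_mult mult_right_mono)
          next
            case False
            then show ?thesis by (simp add: \<phi>_def)
          qed
        qed
        also have "\<dots> = d" using \<phi>_sum[OF x] by (simp flip: sum_distrib_left)
        finally show ?thesis .
      qed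
      have "(\<integral>x. f x \<partial>\<kappa>) - (\<Sum>c\<in>C. f c * (\<integral>x. \<phi> c x \<partial>\<kappa>)) = (\<integral>x. f x - (\<Sum>c\<in>C. f c * \<phi> c x) \<partial>\<kappa>)"
        by simp
      also have "\<bar>\<dots>\<bar> \<le> (\<integral>x. \<bar>f x - (\<Sum>c\<in>C. f c * \<phi> c x)\<bar> \<partial>\<kappa>)" by (rule integral_abs_bound)
      also have "\<dots> \<le> d"
        by (rule integral_le_const)
          (use pt space_prob_algebra_restrict_borel[OF \<kappa>] in \<open>auto intro!: AE_I2\<close>)
      finally show ?thesis .
    qed
    \<comment> \<open>The quantity \<open>?D\<close> does not mention \<open>f\<close>. It bounds
      the difference of the discretised integrals for the whole unit ball, since all coefficients
      satisfy \<open>\<bar>f c\<bar> \<le> 1\<close>.\<close>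
    let ?D = "\<lambda>n. \<Sum>c\<in>C. \<bar>(\<integral>x. \<phi> c x \<partial>\<mu> n) - (\<integral>x. \<phi> c x \<partial>\<nu>)\<bar>"
    have "(\<lambda>n. \<integral>x. \<phi> c x \<partial>\<mu> n) \<longlonglongrightarrow> (\<integral>x. \<phi> c x \<partial>\<nu>)" for c
      using conv \<phi>_cont \<phi>_bdd unfolding weak_conv_on_def by blast
    then have "?D \<longlonglongrightarrow> 0"
      by (intro tendsto_null_sum tendsto_rabs_zero) (simp add: LIM_zero)
    then have "\<forall>\<^sub>F n in sequentially. ?D n < d" by (rule order_tendstoD(2)[OF _ d])
    then show ?thesis
    proof eventually_elim
      case (elim n)
      show ?case unfolding rho_BL_def
      proof (rule SUP_least, clarify, rule ennreal_leI)
        fix f assume f: "BL_norm X f \<le> 1"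
        have "\<bar>(\<Sum>c\<in>C. f c * (\<integral>x. \<phi> c x \<partial>\<mu> n)) - (\<Sum>c\<in>C. f c * (\<integral>x. \<phi> c x \<partial>\<nu>))\<bar>
            = \<bar>\<Sum>c\<in>C. f c * ((\<integral>x. \<phi> c x \<partial>\<mu> n) - (\<integral>x. \<phi> c x \<partial>\<nu>))\<bar>"
          by (simp add: right_diff_distrib sum_subtractf)
        also have "\<dots> \<le> ?D n"
        proof (rule order_trans[OF sum_abs sum_mono])
          fix c assume "c \<in> C"
          then have "\<bar>f c\<bar> \<le> 1" using BL_norm_le_1_abs[OF f] C(2) by auto
          then show "\<bar>f c * ((\<integral>x. \<phi> c x \<partial>\<mu> n) - (\<integral>x. \<phi> c x \<partial>\<nu>))\<bar>
              \<le> \<bar>(\<integral>x. \<phi> c x \<partial>\<mu> n) - (\<integral>x. \<phi> c x \<partial>\<nu>)\<bar>"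
            unfolding abs_mult by (intro mult_left_le_one_le) auto
        qed
        \<comment> \<open>The three summands \<open>d\<close> are the discretisation errors for
          \<open>\<mu> n\<close> and for \<open>\<nu>\<close>, and the bound on
          \<open>?D n\<close>.\<close>
        finally show "\<bar>(\<integral>x. f x \<partial>\<mu> n) - (\<integral>x. f x \<partial>\<nu>)\<bar> \<le> 3 * d"
          using approx[OF \<mu> f, of n] approx[OF \<nu> f] elim by linarith
      qed
    qed
  qed
  show ?thesis
  proof (rule order_tendstoI)
    fix a :: ennreal assume "0 < a"
    then obtain b where b: "0 < b" "b < a" using dense by blast
    \<comment> \<open>Being strictly below \<open>a\<close>, the value \<open>b\<close> is not
      infinite, so it comes from a positive real.\<close>
    then obtain r where r: "b = ennreal r" "0 < r" by (cases b) auto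
    have "\<forall>\<^sub>F n in sequentially. rho_BL X (\<mu> n) \<nu> \<le> b" using bound[of "r / 3"] r by simp
    then show "\<forall>\<^sub>F n in sequentially. rho_BL X (\<mu> n) \<nu> < a"
      by eventually_elim (use b in simp)
  qed simp
qed

section \<open>Passing to and from subsequences\<close>

lemma tendsto_0_if_subsequences:
  fixes f :: "nat \<Rightarrow> ennreal"
  assumes "\<And>r :: nat \<Rightarrow> nat. strict_mono r \<Longrightarrow> \<exists>s. strict_mono s \<and> (\<lambda>n. f (r (s n))) \<longlonglongrightarrow> 0"
  shows "f \<longlonglongrightarrow> 0"
proof (rule order_tendstoI)
  fix a :: ennreal assume a: "0 < a"
  show "\<forall>\<^sub>F n in sequentially. f n < a"
  proof (rule ccontr)
    assume "\<not> ?thesis"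
    \<comment> \<open>On the naturals \<open>sequentially\<close> is the cofinite filter, so failure
      means infinitely many indices with value at least \<open>a\<close>. Enumerating them gives a
      sequence none of whose subsequences tends to 0.\<close>
    then have "infinite {n. a \<le> f n}"
      by (simp add: not_eventually not_less frequently_cofinite flip: cofinite_eq_sequentially)
    then obtain r :: "nat \<Rightarrow> nat" where r: "strict_mono r" "\<And>n. a \<le> f (r n)"
      using infinite_enumerate by (metis mem_Collect_eq)
    from assms[OF r(1)] obtain s where "(\<lambda>n. f (r (s n))) \<longlonglongrightarrow> 0" by blast
    from order_tendstoD(2)[OF this a] have "\<forall>\<^sub>F n in sequentially. False"
      by eventually_elim (use r(2) in \<open>simp add: not_less[symmetric]\<close>)
    then show False by simp
  qed
qed simp

text \<open>Continuous convergence of kernels evaluates \<open>T n\<close> at \<open>z n\<close> for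
  every \<open>n\<close>, whereas compactness yields points only along a subsequence. Filling the
  missing indices with the limit \<open>l\<close> preserves convergence.\<close>

lemma extend_subsequence_tendsto:
  fixes w :: "nat \<Rightarrow> 'a::metric_space"
  assumes "w \<longlonglongrightarrow> l" "strict_mono (r :: nat \<Rightarrow> nat)"
  obtains z where "z \<longlonglongrightarrow> l" "\<And>n. z (r n) = w n" "range z \<subseteq> insert l (range w)"
proof
  have inj: "inj r" using assms(2) by (rule strict_mono_imp_inj_on)
  let ?z = "\<lambda>m. if m \<in> range r then w (inv r m) else l"
  show "?z (r n) = w n" for n using inj by simp
  show "range ?z \<subseteq> insert l (range w)" by auto
  show "?z \<longlonglongrightarrow> l"
  proof (rule metric_LIMSEQ_I)
    fix e :: real assume e: "0 < e"
    then obtain N where N: "\<And>n. n \<ge> N \<Longrightarrow> dist (w n) l < e" using metric_LIMSEQ_D[OF assms(1)] by blast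
    have "dist (?z m) l < e" if "m \<ge> r N" for m
    proof (cases "m \<in> range r")
      case True
      then obtain n where n: "m = r n" by blast
      then have "n \<ge> N" using that assms(2) by (simp add: strict_mono_less_eq)
      then show ?thesis using N n inj by simp
    qed (use e in simp)
    then show "\<exists>N. \<forall>m\<ge>N. dist (?z m) l < e" by blast
  qed
qed

section \<open>The three implications between modes of convergence\<close>

lemma rho_BL_le_rho_unif: "z \<in> X \<times> U \<Longrightarrow> rho_BL X (S z) (T z) \<le> rho_unif X U S T"
  unfolding rho_unif_def by (rule SUP_upper)

text \<open>The path from \<open>T n (z n)\<close> to \<open>S l\<close> goes through
  \<open>S (z n)\<close>: uniform convergence covers the first leg, the weak Feller property of
  \<open>S\<close> the second.\<close>

lemma conv_weakly_continuously_if_uniformly: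
  assumes T: "\<And>n. T n \<in> stochastic_kernels X U" and S: "S \<in> stochastic_kernels X U"
    and Feller: "weak_Feller X U S" and unif: "conv_weakly_uniformly X U T S"
  shows "conv_weakly_continuously X U T S"
  unfolding conv_weakly_continuously_def
proof (intro allI impI, elim conjE)
  fix z :: "nat \<Rightarrow> 'a \<times> 'b" and l
  assume z: "\<forall>n. z n \<in> X \<times> U" and l: "l \<in> X \<times> U" and lim: "z \<longlonglongrightarrow> l"
  show "weak_conv_on X (\<lambda>n. T n (z n)) (S l)"
  proof (rule weak_conv_on_if_BL)
    show "T n (z n) \<in> space (prob_algebra (restrict_space borel X))" for n
      using stochastic_kernels_space[OF T] z by blast
    show "S l \<in> space (prob_algebra (restrict_space borel X))"
      using stochastic_kernels_space[OF S l] .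
    fix h assume h: "BL_norm X h \<le> 1"
    have "(\<lambda>n. rho_BL X (T n (z n)) (S (z n))) \<longlonglongrightarrow> 0"
      by (rule tendsto_sandwich[OF _ _ tendsto_const unif[unfolded conv_weakly_uniformly_def]])
        (use z in \<open>auto intro!: always_eventually rho_BL_le_rho_unif\<close>)
    then have diff: "(\<lambda>n. (\<integral>x. h x \<partial>T n (z n)) - (\<integral>x. h x \<partial>S (z n))) \<longlonglongrightarrow> 0"
      using h by (rule integral_diff_tendsto_0_if_rho_BL)
    have "(\<lambda>n. \<integral>x. h x \<partial>S (z n)) \<longlonglongrightarrow> (\<integral>x. h x \<partial>S l)"
      using Feller z l lim h unfolding weak_Feller_def by (intro weak_conv_on_BL) auto
    from Lim_transform[OF this diff]
    show "(\<lambda>n. \<integral>x. h x \<partial>T n (z n)) \<longlonglongrightarrow> (\<integral>x. h x \<partial>S l)" .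
  qed
qed

lemma conv_weakly_uniformly_if_continuously:
  assumes T: "\<And>n. T n \<in> stochastic_kernels X U" and S: "S \<in> stochastic_kernels X U"
    and X: "compact X" and U: "compact U"
    and Feller: "weak_Feller X U S" and cont: "conv_weakly_continuously X U T S"
  shows "conv_weakly_uniformly X U T S"
  unfolding conv_weakly_uniformly_def
proof (rule order_tendstoI)
  fix a :: ennreal assume "0 < a"
  then obtain b where b: "0 < b" "b < a" using dense by blast
  show "\<forall>\<^sub>F n in sequentially. rho_unif X U (T n) S < a"
  proof (rule ccontr)
    assume "\<not> ?thesis"
    then have "infinite {n. a \<le> rho_unif X U (T n) S}"
      by (simp add: not_eventually not_less frequently_cofinite flip: cofinite_eq_sequentially)
    then obtain r :: "nat \<Rightarrow> nat" where r: "strict_mono r" "\<And>n. a \<le> rho_unif X U (T (r n)) S"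
      using infinite_enumerate by (metis mem_Collect_eq)
    \<comment> \<open>The supremum need not be attained, so the level is lowered from
      \<open>a\<close> to \<open>b\<close> to obtain actual points.\<close>
    have "\<exists>z\<in>X \<times> U. b < rho_BL X (T (r n) z) (S z)" for n
      using order_less_le_trans[OF b(2) r(2)[of n]] by (simp only: rho_unif_def less_SUP_iff)
    then obtain w where w: "\<And>n. w n \<in> X \<times> U" "\<And>n. b < rho_BL X (T (r n) (w n)) (S (w n))"
      by metis
    obtain l s where l: "l \<in> X \<times> U" and s: "strict_mono s" "(w \<circ> s) \<longlonglongrightarrow> l"
      using compact_Times[OF X U, unfolded compact_def, rule_format, of w] w(1) by blast
    obtain z where z: "z \<longlonglongrightarrow> l" "\<And>n. z ((r \<circ> s) n) = (w \<circ> s) n" "range z \<subseteq> insert l (range (w \<circ> s))"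
      using extend_subsequence_tendsto[OF s(2) strict_mono_o[OF r(1) s(1)]] by blast
    have "insert l (range (w \<circ> s)) \<subseteq> X \<times> U" using w(1) l by (simp add: image_subset_iff)
    then have zXU: "z n \<in> X \<times> U" for n using z(3) by blast
    note sp = stochastic_kernels_space
    \<comment> \<open>Compactness of \<open>X\<close> upgrades both weak limits, of
      \<open>T n (z n)\<close> and of \<open>S (z n)\<close>, to \<open>rho_BL\<close>-limits. The
      triangle inequality through \<open>S l\<close> then contradicts the lower bound
      \<open>b\<close> along \<open>r \<circ> s\<close>, where \<open>z\<close> agrees with the
      chosen points.\<close>
    have "(\<lambda>n. rho_BL X (T n (z n)) (S l)) \<longlonglongrightarrow> 0"
      using cont zXU l z(1) unfolding conv_weakly_continuously_def
      by (intro compact_rho_BL_tendsto_0_if_weak_conv_on X sp[OF T] sp[OF S]) auto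
    moreover have "(\<lambda>n. rho_BL X (S (z n)) (S l)) \<longlonglongrightarrow> 0"
      using Feller zXU l z(1) unfolding weak_Feller_def
      by (intro compact_rho_BL_tendsto_0_if_weak_conv_on X sp[OF S]) auto
    ultimately have "(\<lambda>n. rho_BL X (T n (z n)) (S l) + rho_BL X (S (z n)) (S l)) \<longlonglongrightarrow> 0"
      using tendsto_add by fastforce
    then have "\<forall>\<^sub>F n in sequentially. rho_BL X (T n (z n)) (S l) + rho_BL X (S (z n)) (S l) < b"
      by (rule order_tendstoD(2)[OF _ b(1)])
    then have "\<forall>\<^sub>F n in sequentially. rho_BL X (T n (z n)) (S (z n)) < b"
      by eventually_elim
        (rule order_le_less_trans[OF rho_BL_triangle], subst (2) rho_BL_commute, assumption)
    then have "\<forall>\<^sub>F n in sequentially. rho_BL X (T ((r \<circ> s) n) (z ((r \<circ> s) n))) (S (z ((r \<circ> s) n))) < b"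
      by (rule eventually_subseq[OF strict_mono_o[OF r(1) s(1)]])
    then have "\<forall>\<^sub>F n :: nat in sequentially. False"
      by eventually_elim (use w(2) z(2) in \<open>metis comp_apply order_less_asym\<close>)
    then show False by simp
  qed
qed simp

text \<open>Compactness gives every subsequence a further one with a uniform limit \<open>M\<close>.
  At each point the integrals of a bounded Lipschitz function along it tend to those of both
  \<open>M\<close> and \<open>S\<close>, so \<open>M = S\<close>, and the subsequence criterion
  applies.\<close>

lemma conv_weakly_uniformly_if_pointwise:
  assumes MM: "\<MM> \<subseteq> stochastic_kernels X U" and T: "\<And>n. T n \<in> \<MM>" and S: "S \<in> \<MM>"
    and compact: "compact_space (Metric_space.mtopology \<MM> (rho_unif_real X U))"
    and conv: "conv_pointwise_weakly X U T S"
  shows "conv_weakly_uniformly X U T S"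
  unfolding conv_weakly_uniformly_def
proof (rule tendsto_0_if_subsequences)
  interpret Metric_space \<MM> "rho_unif_real X U" by (rule Metric_space_rho_unif[OF MM])
  fix r :: "nat \<Rightarrow> nat" assume r: "strict_mono r"
  have "range (T \<circ> r) \<subseteq> \<MM>" using T by auto
  then obtain M s where M: "M \<in> \<MM>" and s: "strict_mono s"
    and lim: "limitin mtopology (T \<circ> r \<circ> s) M sequentially"
    using compact unfolding compact_space_sequentially by metis
  \<comment> \<open>Compactness is stated for the real-valued metric; the bound by 2 allows its
    limit to be read back in \<open>ennreal\<close>.\<close>
  have fin: "ennreal (rho_unif_real X U (T n) M) = rho_unif X U (T n) M" for n
  proof -
    have "rho_unif X U (T n) M \<le> 2" using T M MM by (intro rho_unif_le_2) auto
    then have "rho_unif X U (T n) M < \<top>" using order_le_less_trans by fastforce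
    then show ?thesis by (simp add: rho_unif_real_def)
  qed
  have "(\<lambda>n. rho_unif_real X U (T (r (s n))) M) \<longlonglongrightarrow> 0"
    using lim by (simp add: limitin_metric_dist_null comp_def)
  then have unif: "(\<lambda>n. rho_unif X U (T (r (s n))) M) \<longlonglongrightarrow> 0"
    using tendsto_ennrealI by (fastforce simp: fin)
  have "M = S"
  proof (rule extensionalityI)
    show "M \<in> extensional (X \<times> U)" "S \<in> extensional (X \<times> U)"
      using M S MM by (auto simp: stochastic_kernels_def)
    fix z assume z: "z \<in> X \<times> U"
    have "(\<integral>x. f x \<partial>M z) = (\<integral>x. f x \<partial>S z)" if f: "BL_norm X f \<le> 1" for f
    proof -
      have "(\<lambda>n. rho_BL X (T (r (s n)) z) (M z)) \<longlonglongrightarrow> 0"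
        by (rule tendsto_sandwich[OF _ _ tendsto_const unif])
          (use z in \<open>auto intro!: always_eventually rho_BL_le_rho_unif\<close>)
      then have "(\<lambda>n. (\<integral>x. f x \<partial>T (r (s n)) z) - (\<integral>x. f x \<partial>M z)) \<longlonglongrightarrow> 0"
        using f by (rule integral_diff_tendsto_0_if_rho_BL)
      then have "(\<lambda>n. \<integral>x. f x \<partial>T (r (s n)) z) \<longlonglongrightarrow> (\<integral>x. f x \<partial>M z)"
        by (rule LIM_zero_cancel)
      moreover have "(\<lambda>n. \<integral>x. f x \<partial>T n z) \<longlonglongrightarrow> (\<integral>x. f x \<partial>S z)"
        using conv z f unfolding conv_pointwise_weakly_def by (intro weak_conv_on_BL) auto
      then have "(\<lambda>n. \<integral>x. f x \<partial>T (r (s n)) z) \<longlonglongrightarrow> (\<integral>x. f x \<partial>S z)"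
        using LIMSEQ_subseq_LIMSEQ[OF _ strict_mono_o[OF r s]] by (fastforce simp: comp_def)
      ultimately show ?thesis by (rule LIMSEQ_unique)
    qed
    then have "rho_BL X (M z) (S z) = 0"
      by (simp add: rho_BL_def SUP_eq_const SUP_constant bot_ennreal)
    then show "M z = S z"
      using M S MM z by (intro rho_BL_zero_imp_eq stochastic_kernels_space) auto
  qed
  then show "\<exists>s. strict_mono s \<and> (\<lambda>n. rho_unif X U (T (r (s n))) S) \<longlonglongrightarrow> 0"
    using s unif by blast
qed

theorem theorem2p8:
  fixes X :: "'x::polish_space set" and U :: "'u::polish_space set"
    and \<MM> :: "('x \<times> 'u \<Rightarrow> 'x measure) set"
    and T :: "nat \<Rightarrow> 'x \<times> 'u \<Rightarrow> 'x measure" and S :: "'x \<times> 'u \<Rightarrow> 'x measure"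
  assumes "X \<in> sets borel" and "U \<in> sets borel" and "compact U"
    and "\<MM> \<subseteq> stochastic_kernels X U"
    and "\<And>n. T n \<in> \<MM>" and "S \<in> \<MM>"
  shows "((\<forall>M\<in>\<MM>. weak_Feller X U M) \<longrightarrow>
            conv_weakly_uniformly X U T S \<longrightarrow> conv_weakly_continuously X U T S)
       \<and> (compact X \<and> compact U \<and> (\<forall>M\<in>\<MM>. weak_Feller X U M) \<longrightarrow>
            conv_weakly_continuously X U T S \<longrightarrow> conv_weakly_uniformly X U T S)
       \<and> (compact_space (Metric_space.mtopology \<MM> (rho_unif_real X U)) \<and> (\<forall>M\<in>\<MM>. weak_Feller X U M) \<longrightarrow>
            conv_pointwise_weakly X U T S \<longrightarrow> conv_weakly_uniformly X U T S)"
proof (intro conjI impI)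
  have T: "T n \<in> stochastic_kernels X U" for n using assms(4,5) by blast
  have S: "S \<in> stochastic_kernels X U" using assms(4,6) by blast
  show "conv_weakly_continuously X U T S"
    if "\<forall>M\<in>\<MM>. weak_Feller X U M" "conv_weakly_uniformly X U T S"
    using conv_weakly_continuously_if_uniformly[where T = T, OF T S] that assms(6) by blast
  show "conv_weakly_uniformly X U T S"
    if "compact X \<and> compact U \<and> (\<forall>M\<in>\<MM>. weak_Feller X U M)" "conv_weakly_continuously X U T S"
    using conv_weakly_uniformly_if_continuously[where T = T, OF T S] that assms(6) by blast
  show "conv_weakly_uniformly X U T S"
    if "compact_space (Metric_space.mtopology \<MM> (rho_unif_real X U)) \<and> (\<forall>M\<in>\<MM>. weak_Feller X U M)"
      "conv_pointwise_weakly X U T S"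
    using conv_weakly_uniformly_if_pointwise[where T = T, OF assms(4-6)] that by blast
qed

end
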